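(* For $n\ge3$ and $i,j\in[n]$ with $i\ne j$ let $s(n;i,j)=|\{\pi\in\mathrm{Av}_n^{132}(132,213):\pi_1=i,\ \pi_2=j\}|$. Then $$\Pr(132\prec213)=\sum_{n\ge3}\ \sum_{\substack{i,j=1\\ i\neq j}}^n\frac{s(n;i,j)}{n!}\approx0.461.$$
   Context: For a sequence of distinct reals, $\mathrm{st}$ replaces the smallest entry by $1$, the second smallest by $2$, etc. Let $X_1,X_2,\dots$ be i.i.d. continuous random variables (e.g. uniform on $[0,1]$). A consecutive occurrence of a permutation $\sigma$ of $\{1,\dots,k\}$ in a sequence or permutation is a block of $k$ adjacent entries whose standardization is $\sigma$. For distinct permutations $\sigma,\tau$ of the same length, $\Pr(\sigma\prec\tau)$ is the probability that the first consecutive occurrence of $\sigma$ in $X_1,X_2,\dots$ appears before the first consecutive occurrence of $\tau$. $\mathrm{Av}_n^{132}(132,213)$ is the set of permutations of $[n]=\{1,\dots,n\}$ whose last three entries form a consecutive occurrence of $132$ and which have no other consecutive occurrence of $132$ or $213$. *)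

theory Defs
  imports "HOL-Probability.Probability" "HOL-Combinatorics.Multiset_Permutations"
begin

text \<open>Permutations of \<open>{1..k}\<close> are lists in one-line notation, i.e. elements of
  \<^term>\<open>permutations_of_set {1..k::nat}\<close>. Positions in lists and sequences are counted from 0,
  so that \<open>X\<^sub>1, X\<^sub>2, \<dots>\<close> is \<open>X 0, X 1, \<dots>\<close> and \<open>\<pi>\<^sub>1\<close> is \<open>\<pi> ! 0\<close>.\<close>

definition st :: "'a::linorder list \<Rightarrow> nat list" where
  "st xs = map (\<lambda>x. card {y \<in> set xs. y \<le> x}) xs"

text \<open>If the block has repeated entries (a null event in the probabilistic setting), its image
  under \<^const>\<open>st\<close> also has repeated entries, so no permutation occurs there.\<close>

definition occurs_at :: "nat list \<Rightarrow> (nat \<Rightarrow> 'a::linorder) \<Rightarrow> nat \<Rightarrow> bool" where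
  "occurs_at \<sigma> x p \<longleftrightarrow> st (map x [p..<p + length \<sigma>]) = \<sigma>"

definition occurs_in_at :: "nat list \<Rightarrow> 'a::linorder list \<Rightarrow> nat \<Rightarrow> bool" where
  "occurs_in_at \<sigma> xs p \<longleftrightarrow> p + length \<sigma> \<le> length xs \<and> occurs_at \<sigma> (\<lambda>i. xs ! i) p"

text \<open>\<open>Av \<rho> T n\<close> is \<open>Av\<^sub>n\<^sup>\<rho>(T)\<close>.\<close>

definition Av :: "nat list \<Rightarrow> nat list set \<Rightarrow> nat \<Rightarrow> nat list set" where
  "Av \<rho> T n = {\<pi> \<in> permutations_of_set {1..n}.
     occurs_in_at \<rho> \<pi> (n - length \<rho>) \<and>
     (\<forall>\<sigma>\<in>T. \<forall>p. occurs_in_at \<sigma> \<pi> p \<longrightarrow> \<sigma> = \<rho> \<and> p = n - length \<rho>)}"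

text \<open>This is \<open>s(n; i, j)\<close>.\<close>

definition start_count :: "nat \<Rightarrow> nat \<Rightarrow> nat \<Rightarrow> nat" where
  "start_count n i j = card {\<pi> \<in> Av [1,3,2] {[1,3,2], [2,1,3]} n. \<pi> ! 0 = i \<and> \<pi> ! 1 = j}"

text \<open>A continuous random variable is one with continuous distribution function; a density is
  not required.\<close>

definition iid_continuous :: "'a measure \<Rightarrow> (nat \<Rightarrow> 'a \<Rightarrow> real) \<Rightarrow> bool" where
  "iid_continuous M X \<longleftrightarrow>
     prob_space M \<and>
     prob_space.indep_vars M (\<lambda>_. borel) X UNIV \<and>
     (\<forall>i. distr M borel (X i) = distr M borel (X 0)) \<and>
     continuous_on UNIV (cdf (distr M borel (X 0)))"

text \<open>The value is \<open>\<infinity>\<close> if there is no occurrence.\<close>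

definition first_occurrence :: "nat list \<Rightarrow> (nat \<Rightarrow> real) \<Rightarrow> enat" where
  "first_occurrence \<sigma> x = (INF p \<in> {p. occurs_at \<sigma> x p}. enat p)"

definition prob_before ::
  "'a measure \<Rightarrow> (nat \<Rightarrow> 'a \<Rightarrow> real) \<Rightarrow> nat list \<Rightarrow> nat list \<Rightarrow> real" where
  "prob_before M X \<sigma> \<tau> = measure M
     {\<omega> \<in> space M. first_occurrence \<sigma> (\<lambda>i. X i \<omega>) < first_occurrence \<tau> (\<lambda>i. X i \<omega>)}"

end

theory Submission
  imports Defs
begin

text \<open>Almost surely the \<open>X\<^sub>i\<close> are distinct, and by exchangeability every permutation of
  \<open>{1..n}\<close> is equally likely to be the order type of the first \<open>n\<close> of them
  (\<open>prob_order_event\<close>). If 132 occurs before 213, the first 132 ends at a unique time \<open>n\<close>, and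
  ``the first 132 ends at time \<open>n\<close> and no 213 came earlier'' says precisely that the order type of
  the first \<open>n\<close> variables lies in \<open>Av\<^sub>n\<^sup>132(132,213)\<close>. Hence the probability is the sum of
  \<open>|Av\<^sub>n\<^sup>132(132,213)| / n!\<close> (\<open>prob_before_sums\<close>), and sorting these permutations by their first
  two entries gives the double sum.

  For the numerical value, the race is still undecided after \<open>n\<close> variables exactly when their order
  type avoids both patterns. So the partial sum up to \<open>n\<close> errs by at most \<open>c / n!\<close>, where \<open>c\<close> counts
  the permutations of \<open>{1..n}\<close> avoiding both. This error decays geometrically, by a factor of
  about 0.68 per step, and \<open>n = 23\<close> is enough: the probability then lies between
  0.46122 and 0.46150.

  These counts are far too large to enumerate, but which values may be appended to an
  avoider depends only on its last two entries. The number of avoiders with last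
  entries \<open>(i, j)\<close> therefore satisfies a recurrence (\<open>pair_count_Suc\<close>) which tabulates all of them
  with polynomially many additions; the table for \<open>n = 23\<close> is then computed by rewriting
  (\<open>tally_21_bounds\<close>).\<close>

section \<open>Order types of sequences\<close>

text \<open>Working with this relation instead of \<^const>\<open>st\<close> turns every pattern condition into finitely
  many comparisons, which makes measurability and invariance immediate. The two sequences may have
  different types, since a real sequence is to be compared with a permutation.\<close>
definition same_order :: "nat \<Rightarrow> (nat \<Rightarrow> 'a::linorder) \<Rightarrow> (nat \<Rightarrow> 'b::linorder) \<Rightarrow> bool" where
  "same_order n x y \<longleftrightarrow> (\<forall>i<n. \<forall>j<n. x i < x j \<longleftrightarrow> y i < y j)"

lemma occurs_at_132_iff:
  "occurs_at [1,3,2] x p \<longleftrightarrow> x p < x (p + 2) \<and> x (p + 2) < x (p + 1)"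
proof -
  have *: "[p..<p + length [1,3,2::nat]] = [p, p + 1, p + 2]"
    by (simp add: upt_rec)
  have **: "{y. (y = a \<or> y = b \<or> y = c) \<and> y \<le> d} =
      (if a \<le> d then {a} else {}) \<union> (if b \<le> d then {b} else {}) \<union> (if c \<le> d then {c} else {})"
    for a b c d :: 'a by auto
  show ?thesis unfolding occurs_at_def st_def *
    by (cases "x p" "x (p+1)" rule: linorder_cases; cases "x p" "x (p+2)" rule: linorder_cases;
        cases "x (p+1)" "x (p+2)" rule: linorder_cases)
      (auto simp: ** card_insert_if)
qed

lemma occurs_at_213_iff:
  "occurs_at [2,1,3] x p \<longleftrightarrow> x (p + 1) < x p \<and> x p < x (p + 2)"
proof -
  have *: "[p..<p + length [2,1,3::nat]] = [p, p + 1, p + 2]"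
    by (simp add: upt_rec)
  have **: "{y. (y = a \<or> y = b \<or> y = c) \<and> y \<le> d} =
      (if a \<le> d then {a} else {}) \<union> (if b \<le> d then {b} else {}) \<union> (if c \<le> d then {c} else {})"
    for a b c d :: 'a by auto
  show ?thesis unfolding occurs_at_def st_def *
    by (cases "x p" "x (p+1)" rule: linorder_cases; cases "x p" "x (p+2)" rule: linorder_cases;
        cases "x (p+1)" "x (p+2)" rule: linorder_cases)
      (auto simp: ** card_insert_if)
qed

lemma permutation_of_interval_nth:
  assumes "\<pi> \<in> permutations_of_set {1..n::nat}"
  shows "length \<pi> = n" "distinct \<pi>" "set \<pi> = {1..n}"
    and "bij_betw ((!) \<pi>) {..<n} {1..n}"
proof -
  show 1: "length \<pi> = n" "distinct \<pi>" "set \<pi> = {1..n}"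
    using assms length_finite_permutations_of_set[OF assms] by (auto simp: permutations_of_set_def)
  show "bij_betw ((!) \<pi>) {..<n} {1..n}"
    using bij_betw_nth[OF 1(2), of "{..<n}" "{1..n}"] 1 by auto
qed

text \<open>A permutation of \<open>{1..n}\<close> is its own standardization.\<close>
lemma card_below_permutation_entry:
  assumes "\<pi> \<in> permutations_of_set {1..n::nat}" "i < n"
  shows "card {j. j < n \<and> \<pi> ! j \<le> \<pi> ! i} = \<pi> ! i"
proof -
  note p = permutation_of_interval_nth[OF assms(1)]
  have "\<pi> ! i \<in> {1..n}" using p assms(2) nth_mem by metis
  then have "(!) \<pi> ` {j. j < n \<and> \<pi> ! j \<le> \<pi> ! i} = {1..\<pi> ! i}"
    (is "?l = ?r")
  proof (intro equalityI subsetI)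
    fix v assume "v \<in> ?l" then show "v \<in> ?r" using p(4) by (auto simp: bij_betw_def)
  next
    fix v assume v: "v \<in> ?r"
    with \<open>\<pi> ! i \<in> {1..n}\<close> have "v \<in> (!) \<pi> ` {..<n}" using p(4) by (auto simp: bij_betw_def)
    then show "v \<in> ?l" using v by auto
  qed
  moreover have "inj_on ((!) \<pi>) {j. j < n \<and> \<pi> ! j \<le> \<pi> ! i}"
    using p(4) by (auto simp: bij_betw_def inj_on_def)
  ultimately show ?thesis by (metis card_atLeastAtMost card_image diff_Suc_1)
qed

lemma same_order_imp_inj:
  assumes "\<pi> \<in> permutations_of_set {1..n::nat}" "same_order n x ((!) \<pi>)"
  shows "inj_on x {..<n}"
proof (rule inj_onI)
  fix i j assume ij: "i \<in> {..<n}" "j \<in> {..<n}" "x i = x j"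
  then have "\<pi> ! i = \<pi> ! j" using assms(2) unfolding same_order_def
    by (metis lessThan_iff less_irrefl linorder_less_linear)
  then show "i = j" using permutation_of_interval_nth[OF assms(1)] ij
    by (simp add: nth_eq_iff_index_eq)
qed

lemma st_eq_if_same_order:
  assumes "\<pi> \<in> permutations_of_set {1..n::nat}" "same_order n x ((!) \<pi>)"
  shows "st (map x [0..<n]) = \<pi>"
proof (rule nth_equalityI)
  note p = permutation_of_interval_nth[OF assms(1)]
  show "length (st (map x [0..<n])) = length \<pi>" using p by (simp add: st_def)
  fix i assume "i < length (st (map x [0..<n]))"
  then have i: "i < n" by (simp add: st_def)
  have "{y \<in> set (map x [0..<n]). y \<le> x i} = x ` {j. j < n \<and> x j \<le> x i}" by auto
  also have "card \<dots> = card {j. j < n \<and> x j \<le> x i}"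
    by (rule card_image) (use same_order_imp_inj[OF assms] in \<open>auto simp: inj_on_def\<close>)
  also have "{j. j < n \<and> x j \<le> x i} = {j. j < n \<and> \<pi> ! j \<le> \<pi> ! i}"
    using assms(2) i unfolding same_order_def by (metis linorder_not_less)
  finally show "st (map x [0..<n]) ! i = \<pi> ! i"
    using i card_below_permutation_entry[OF assms(1) i] by (simp add: st_def)
qed

lemma st_of_inj:
  assumes "inj_on x {..<n}"
  shows "st (map x [0..<n]) \<in> permutations_of_set {1..n}"
    and "same_order n x ((!) (st (map x [0..<n])))"
proof -
  define r where "r i = card {j. j < n \<and> x j \<le> x i}" for i
  have nth: "st (map x [0..<n]) = map r [0..<n]"
  proof -
    have "card {y. (\<exists>k\<in>{0..<n}. y = x k) \<and> y \<le> x i} = r i" for i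
    proof -
      have "{y. (\<exists>k\<in>{0..<n}. y = x k) \<and> y \<le> x i} = x ` {j. j < n \<and> x j \<le> x i}" by auto
      then show ?thesis unfolding r_def
        by (simp add: card_image inj_on_subset[OF assms] subset_eq)
    qed
    then show ?thesis by (simp add: st_def image_def)
  qed
  have mono: "r i < r j" if "i < n" "j < n" "x i < x j" for i j
  proof -
    have "{k. k < n \<and> x k \<le> x i} \<subseteq> {k. k < n \<and> x k \<le> x j}" using that(3) by auto
    moreover have "j \<in> {k. k < n \<and> x k \<le> x j} - {k. k < n \<and> x k \<le> x i}" using that by auto
    ultimately have "{k. k < n \<and> x k \<le> x i} \<subset> {k. k < n \<and> x k \<le> x j}" by blast
    then show ?thesis unfolding r_def by (rule psubset_card_mono[rotated]) simp
  qed
  have iff: "r i < r j \<longleftrightarrow> x i < x j" if "i < n" "j < n" for i j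
    using mono[OF that] mono[OF that(2,1)] less_asym r_def
    by (metis less_irrefl linorder_less_linear)
  have inj: "inj_on r {..<n}"
  proof (rule inj_onI)
    fix i j assume "i \<in> {..<n}" "j \<in> {..<n}" "r i = r j"
    then have "\<not> x i < x j" "\<not> x j < x i" using iff[of i j] iff[of j i] by auto
    then show "i = j" using assms \<open>i \<in> {..<n}\<close> \<open>j \<in> {..<n}\<close> by (auto simp: inj_on_def)
  qed
  have sub: "r ` {..<n} \<subseteq> {1..n}"
  proof (intro subsetI, elim imageE, hypsubst)
    fix i assume "i \<in> {..<n}"
    then have "card {i} \<le> r i" "r i \<le> card {..<n}"
      unfolding r_def by (intro card_mono; auto)+
    then show "r i \<in> {1..n}" by simp
  qed
  have "r ` {..<n} = {1..n}"
    by (rule card_subset_eq) (use sub inj in \<open>auto simp: card_image\<close>)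
  then show "st (map x [0..<n]) \<in> permutations_of_set {1..n}"
    using inj by (simp add: nth permutations_of_set_def distinct_map atLeast0LessThan)
  show "same_order n x ((!) (st (map x [0..<n])))"
    unfolding same_order_def using iff by (simp add: nth)
qed

section \<open>The order type of i.i.d. continuous variables is uniform\<close>

text \<open>The diagonal is a null set of the product of an atomless law with itself, by Fubini.\<close>
lemma AE_no_tie:
  assumes "iid_continuous M X" "i \<noteq> j"
  shows "AE \<omega> in M. X i \<omega> \<noteq> X j \<omega>"
proof -
  interpret prob_space M using assms(1) by (simp add: iid_continuous_def)
  have indep: "indep_vars (\<lambda>_. borel) X UNIV" and
    D: "distr M borel (X k) = distr M borel (X 0)" for k
    using assms(1) by (auto simp: iid_continuous_def)
  have rv[measurable]: "random_variable borel (X k)" for k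
    using indep by (auto simp: indep_vars_def)
  let ?D = "distr M borel (X 0)"
  interpret D: real_distribution ?D by (rule real_distribution_distr) simp
  have null: "emeasure ?D {x} = 0" for x
  proof -
    have "isCont (cdf ?D) x"
      using assms(1) by (simp add: iid_continuous_def continuous_on_eq_continuous_at)
    then show ?thesis by (simp add: D.isCont_cdf D.emeasure_eq_measure)
  qed
  have "indep_var borel ((\<lambda>f. f i) \<circ> (\<lambda>\<omega>. restrict (\<lambda>i. X i \<omega>) {i}))
      borel ((\<lambda>f. f j) \<circ> (\<lambda>\<omega>. restrict (\<lambda>i. X i \<omega>) {j}))"
    by (intro indep_var_compose[OF indep_var_restrict[OF indep]]) (use assms(2) in auto)
  then have "indep_var borel (X i) borel (X j)" by (simp add: comp_def)
  then have joint: "distr M (borel \<Otimes>\<^sub>M borel) (\<lambda>\<omega>. (X i \<omega>, X j \<omega>)) = ?D \<Otimes>\<^sub>M ?D"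
    unfolding indep_var_distribution_eq D[of i] D[of j] by simp
  have "{z \<in> space (borel \<Otimes>\<^sub>M borel). fst z = (snd z :: real)} \<in> sets (borel \<Otimes>\<^sub>M borel)"
    by measurable
  then have meas: "{z. fst z = snd z} \<in> sets (?D \<Otimes>\<^sub>M ?D)"
    by (simp add: space_pair_measure cong: sets_pair_measure_cong)
  have "emeasure (?D \<Otimes>\<^sub>M ?D) {z. fst z = snd z} = (\<integral>\<^sup>+x. emeasure ?D {x} \<partial>?D)"
    by (subst D.emeasure_pair_measure_alt[OF meas])
      (auto intro!: nn_integral_cong arg_cong[where f = "emeasure _"])
  also have "\<dots> = 0" by (simp add: null)
  finally have "{z. fst z = snd z} \<in> null_sets (?D \<Otimes>\<^sub>M ?D)" using meas by auto
  then have "AE z in distr M (borel \<Otimes>\<^sub>M borel) (\<lambda>\<omega>. (X i \<omega>, X j \<omega>)). fst z \<noteq> snd z"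
    unfolding joint by (rule AE_I') auto
  then show ?thesis by (subst (asm) AE_distr_iff) (auto intro: borel_measurable_neq)
qed

lemma AE_inj:
  assumes "iid_continuous M X"
  shows "AE \<omega> in M. inj (\<lambda>i. X i \<omega>)"
proof -
  have "AE \<omega> in M. \<forall>i j. i \<noteq> j \<longrightarrow> X i \<omega> \<noteq> X j \<omega>"
    using AE_no_tie[OF assms] by (auto simp: AE_all_countable)
  then show ?thesis by eventually_elim (auto simp: inj_on_def)
qed

lemma measurable_same_order [measurable]:
  fixes X :: "nat \<Rightarrow> 'a \<Rightarrow> real" and y :: "nat \<Rightarrow> nat"
  assumes [measurable]: "\<And>i. X i \<in> borel_measurable M"
  shows "Measurable.pred M (\<lambda>\<omega>. same_order n (\<lambda>i. X i \<omega>) y)"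
  unfolding same_order_def by measurable

text \<open>Exchangeability: having order type \<open>\<pi>\<close> means that the variables are increasing when read in
  the order given by the inverse of \<open>\<pi>\<close>, and permuting the coordinates of a product of
  identical laws does not change it.\<close>
lemma prob_same_order_eq_sorted:
  assumes iid: "iid_continuous M X" and \<pi>: "\<pi> \<in> permutations_of_set {1..n}"
  shows "measure M {\<omega> \<in> space M. same_order n (\<lambda>i. X i \<omega>) ((!) \<pi>)} =
    measure M {\<omega> \<in> space M. same_order n (\<lambda>i. X i \<omega>) (\<lambda>i. i)}"
proof (cases "n = 0")
  case True then show ?thesis by (simp add: same_order_def)
next
  case False
  interpret prob_space M using iid by (simp add: iid_continuous_def)
  have indep: "indep_vars (\<lambda>_. borel) X UNIV" and
    D: "distr M borel (X k) = distr M borel (X 0)" for k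
    using iid by (auto simp: iid_continuous_def)
  have rv[measurable]: "random_variable borel (X k)" for k
    using indep by (auto simp: indep_vars_def)
  let ?D = "distr M borel (X 0)" and ?I = "{..<n}"
  let ?V = "\<lambda>\<omega>. \<lambda>i\<in>?I. X i \<omega>"
  have "prob_space ?D" by (rule prob_space_distr) simp
  have marginals: "(\<Pi>\<^sub>M i\<in>?I. distr M borel (X i)) = (\<Pi>\<^sub>M i\<in>?I. ?D)"
    by (rule PiM_cong[OF refl D])
  have joint: "distr M (\<Pi>\<^sub>M i\<in>?I. borel) ?V = (\<Pi>\<^sub>M i\<in>?I. ?D)"
    using indep_vars_iff_distr_eq_PiM[where I = ?I and M' = "\<lambda>_. borel" and X = X] False rv
      indep_vars_subset[OF indep subset_UNIV] marginals by auto
  \<comment> \<open>the position of the value \<open>u + 1\<close> in \<open>\<pi>\<close>\<close>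
  define t where "t u = the_inv_into ?I ((!) \<pi>) (Suc u)" for u
  note p = permutation_of_interval_nth[OF \<pi>]
  have "bij_betw t ?I ?I"
  proof -
    have "bij_betw Suc ?I {1..n}"
      by (rule bij_betwI[where g = "\<lambda>k. k - 1"]) auto
    from bij_betw_trans[OF this bij_betw_the_inv_into[OF p(4)]] show ?thesis
      unfolding t_def[abs_def] by (simp add: comp_def)
  qed
  have \<pi>t: "\<pi> ! t u = Suc u" if "u < n" for u
    unfolding t_def using that p(4) by (intro f_the_inv_into_f_bij_betw[OF p(4)]) auto
  let ?r = "\<lambda>x. \<lambda>u\<in>?I. x (t u)"
  have reindex: "distr (\<Pi>\<^sub>M i\<in>?I. ?D) (\<Pi>\<^sub>M i\<in>?I. ?D) ?r = (\<Pi>\<^sub>M i\<in>?I. ?D)"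
    using distr_PiM_reindex[of ?I "\<lambda>_. ?D" t ?I] \<open>prob_space ?D\<close> \<open>bij_betw t ?I ?I\<close>
    by (auto simp: bij_betw_def)
  have so: "same_order n x ((!) \<pi>) \<longleftrightarrow> same_order n (?r x) (\<lambda>i. i)" for x :: "nat \<Rightarrow> real"
  proof -
    have "same_order n x ((!) \<pi>) \<longleftrightarrow> (\<forall>i\<in>?I. \<forall>j\<in>?I. x i < x j \<longleftrightarrow> \<pi> ! i < \<pi> ! j)"
      by (auto simp: same_order_def)
    also have "\<dots> \<longleftrightarrow> (\<forall>u\<in>?I. \<forall>v\<in>?I. x (t u) < x (t v) \<longleftrightarrow> \<pi> ! t u < \<pi> ! t v)"
    proof -
      have "(\<forall>i\<in>t ` ?I. \<forall>j\<in>t ` ?I. P i j) \<longleftrightarrow> (\<forall>u\<in>?I. \<forall>v\<in>?I. P (t u) (t v))" for P by blast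
      from this[of "\<lambda>i j. x i < x j \<longleftrightarrow> \<pi> ! i < \<pi> ! j"] show ?thesis
        unfolding bij_betw_imp_surj_on[OF \<open>bij_betw t ?I ?I\<close>] .
    qed
    also have "\<dots> \<longleftrightarrow> same_order n (?r x) (\<lambda>i. i)"
      by (auto simp: same_order_def \<pi>t)
    finally show ?thesis .
  qed
  have tn: "t u < n" if "u < n" for u using \<open>bij_betw t ?I ?I\<close> that by (auto simp: bij_betw_def)
  have [measurable]: "Measurable.pred (\<Pi>\<^sub>M i\<in>?I. borel) (\<lambda>x. same_order n (x :: nat \<Rightarrow> real) (y :: nat \<Rightarrow> nat))" for y
    unfolding same_order_def by measurable
  let ?P = "\<Pi>\<^sub>M i\<in>?I. (borel :: real measure)"
  have 1: "measure M {\<omega> \<in> space M. same_order n (\<lambda>i. X i \<omega>) y} =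
    measure (\<Pi>\<^sub>M i\<in>?I. ?D) {x \<in> space ?P. same_order n x y}" for y :: "nat \<Rightarrow> nat"
    unfolding joint[symmetric]
    by (subst measure_distr) (auto intro!: arg_cong[where f = "measure M"] simp: same_order_def space_PiM)
  have "measure (\<Pi>\<^sub>M i\<in>?I. ?D) {x \<in> space ?P. same_order n x (\<lambda>i. i)} =
    measure (distr (\<Pi>\<^sub>M i\<in>?I. ?D) (\<Pi>\<^sub>M i\<in>?I. ?D) ?r) {x \<in> space ?P. same_order n x (\<lambda>i. i)}"
    by (simp only: reindex)
  also have "\<dots> = measure (\<Pi>\<^sub>M i\<in>?I. ?D) {x \<in> space ?P. same_order n x ((!) \<pi>)}"
  proof (subst measure_distr)
    show "?r \<in> (\<Pi>\<^sub>M i\<in>?I. ?D) \<rightarrow>\<^sub>M (\<Pi>\<^sub>M i\<in>?I. ?D)"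
      using tn by (intro measurable_restrict measurable_component_singleton) auto
    have "{x \<in> space ?P. same_order n x (\<lambda>i. i)} \<in> sets ?P" by measurable
    also have "sets ?P = sets (\<Pi>\<^sub>M i\<in>?I. ?D)" by (intro sets_PiM_cong) auto
    finally show "{x \<in> space ?P. same_order n x (\<lambda>i. i)} \<in> sets (\<Pi>\<^sub>M i\<in>?I. ?D)" .
    show "measure (\<Pi>\<^sub>M i\<in>?I. ?D)
       (?r -` {x \<in> space ?P. same_order n x (\<lambda>i. i)} \<inter> space (\<Pi>\<^sub>M i\<in>?I. ?D)) =
      measure (\<Pi>\<^sub>M i\<in>?I. ?D) {x \<in> space ?P. same_order n x ((!) \<pi>)}"
      by (intro arg_cong[where f = "measure _"]) (auto simp: so space_PiM)
  qed
  finally show ?thesis by (simp add: 1)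
qed

text \<open>Each tie-free outcome has exactly one order type, so an event that can be read off the order of
  the first \<open>n\<close> variables is, up to a null set, a disjoint union over permutations.\<close>
lemma prob_order_event_eq_sum:
  assumes iid: "iid_continuous M X"
    and R: "{\<omega> \<in> space M. R (\<lambda>i. X i \<omega>)} \<in> sets M"
    and inv: "\<And>x \<pi>. same_order n x ((!) \<pi>) \<Longrightarrow> length \<pi> = n \<Longrightarrow> R x \<longleftrightarrow> Q \<pi>"
  shows "measure M {\<omega> \<in> space M. R (\<lambda>i. X i \<omega>)} =
    (\<Sum>\<pi> | \<pi> \<in> permutations_of_set {1..n} \<and> Q \<pi>.
      measure M {\<omega> \<in> space M. same_order n (\<lambda>i. X i \<omega>) ((!) \<pi>)})"
proof -
  interpret prob_space M using iid by (simp add: iid_continuous_def)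
  have rv[measurable]: "random_variable borel (X k)" for k
    using iid by (auto simp: indep_vars_def iid_continuous_def)
  let ?S = "{\<pi> \<in> permutations_of_set {1..n}. Q \<pi>}"
  let ?E = "\<lambda>\<rho>. {\<omega> \<in> space M. same_order n (\<lambda>i. X i \<omega>) ((!) \<rho>)}"
  have len: "length \<pi> = n" if "\<pi> \<in> permutations_of_set {1..n}" for \<pi>
    using permutation_of_interval_nth[OF that] by simp
  have "AE \<omega> in M. \<omega> \<in> {\<omega> \<in> space M. R (\<lambda>i. X i \<omega>)} \<longleftrightarrow> \<omega> \<in> (\<Union>\<rho>\<in>?S. ?E \<rho>)"
    using AE_inj[OF iid] AE_space
  proof eventually_elim
    case (elim \<omega>)
    then have "inj_on (\<lambda>i. X i \<omega>) {..<n}" by (auto intro: inj_on_subset)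
    from st_of_inj[OF this] elim inv len show ?case by blast
  qed
  then have "measure M {\<omega> \<in> space M. R (\<lambda>i. X i \<omega>)} = measure M (\<Union>\<rho>\<in>?S. ?E \<rho>)"
    by (rule measure_eq_AE) (use R in auto)
  also have "\<dots> = (\<Sum>\<rho>\<in>?S. measure M (?E \<rho>))"
  proof (rule finite_measure_finite_Union)
    show "disjoint_family_on ?E ?S"
      unfolding disjoint_family_on_def
    proof (intro ballI impI, rule ccontr)
      fix \<rho> \<rho>' assume *: "\<rho> \<in> ?S" "\<rho>' \<in> ?S" "\<rho> \<noteq> \<rho>'" "?E \<rho> \<inter> ?E \<rho>' \<noteq> {}"
      then obtain \<omega> where "same_order n (\<lambda>i. X i \<omega>) ((!) \<rho>)" "same_order n (\<lambda>i. X i \<omega>) ((!) \<rho>')"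
        by auto
      then show False using st_eq_if_same_order *(1-3) by (metis (no_types, lifting) mem_Collect_eq)
    qed
  qed auto
  finally show ?thesis .
qed

text \<open>The \<open>n!\<close> order types have the same probability and their probabilities add up to 1.\<close>
lemma prob_same_order:
  assumes iid: "iid_continuous M X" and \<pi>: "\<pi> \<in> permutations_of_set {1..n}"
  shows "measure M {\<omega> \<in> space M. same_order n (\<lambda>i. X i \<omega>) ((!) \<pi>)} = 1 / fact n"
proof -
  interpret prob_space M using iid by (simp add: iid_continuous_def)
  have "1 = (\<Sum>\<rho>\<in>permutations_of_set {1..n}.
      measure M {\<omega> \<in> space M. same_order n (\<lambda>i. X i \<omega>) ((!) \<rho>)})"
    using prob_order_event_eq_sum[OF iid, of "\<lambda>_. True" n "\<lambda>_. True"] by (simp add: prob_space)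
  also have "\<dots> = fact n * measure M {\<omega> \<in> space M. same_order n (\<lambda>i. X i \<omega>) ((!) \<pi>)}"
    using prob_same_order_eq_sorted[OF iid] \<pi> by simp
  finally show ?thesis by (simp add: field_simps)
qed

lemma prob_order_event:
  assumes iid: "iid_continuous M X"
    and R: "{\<omega> \<in> space M. R (\<lambda>i. X i \<omega>)} \<in> sets M"
    and inv: "\<And>x \<pi>. same_order n x ((!) \<pi>) \<Longrightarrow> length \<pi> = n \<Longrightarrow> R x \<longleftrightarrow> Q \<pi>"
  shows "measure M {\<omega> \<in> space M. R (\<lambda>i. X i \<omega>)} =
    real (card {\<pi> \<in> permutations_of_set {1..n}. Q \<pi>}) / fact n"
  using prob_order_event_eq_sum[OF assms] prob_same_order[OF iid] by simp

section \<open>Avoiding 132 and 213\<close>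

text \<open>Only the first \<open>n\<close> terms of the sequence matter: an occurrence at \<open>q\<close> uses the
  positions \<open>q\<close> to \<open>q + 2\<close>.\<close>
definition avoids :: "nat \<Rightarrow> (nat \<Rightarrow> 'a::linorder) \<Rightarrow> bool" where
  "avoids n x \<longleftrightarrow> (\<forall>q. q + 3 \<le> n \<longrightarrow> \<not> occurs_at [1,3,2] x q \<and> \<not> occurs_at [2,1,3] x q)"

text \<open>The window of length \<open>p + 2\<close> contains exactly the blocks that start before \<open>p\<close>. A 213 at \<open>p\<close>
  itself is impossible, because 132 occurs there.\<close>
definition first_132_at :: "(nat \<Rightarrow> 'a::linorder) \<Rightarrow> nat \<Rightarrow> bool" where
  "first_132_at x p \<longleftrightarrow> occurs_at [1,3,2] x p \<and> avoids (p + 2) x"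

definition avoiders :: "nat \<Rightarrow> nat list set" where
  "avoiders n = {\<pi> \<in> permutations_of_set {1..n}. avoids n ((!) \<pi>)}"

lemma same_order_occurs_at:
  assumes "same_order n x y" "q + 3 \<le> n"
  shows "occurs_at [1,3,2] x q \<longleftrightarrow> occurs_at [1,3,2] y q"
    and "occurs_at [2,1,3] x q \<longleftrightarrow> occurs_at [2,1,3] y q"
  using assms unfolding occurs_at_132_iff occurs_at_213_iff same_order_def by auto

lemma same_order_avoids:
  assumes "same_order n x y" "k \<le> n"
  shows "avoids k x \<longleftrightarrow> avoids k y"
  using same_order_occurs_at[OF assms(1)] assms(2) unfolding avoids_def
  by (meson le_trans)

lemma avoids_Suc:
  assumes "2 \<le> n"
  shows "avoids (Suc n) x \<longleftrightarrow>
    avoids n x \<and> \<not> occurs_at [1,3,2] x (n - 2) \<and> \<not> occurs_at [2,1,3] x (n - 2)"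
proof -
  have "q + 3 \<le> Suc n \<longleftrightarrow> q + 3 \<le> n \<or> q = n - 2" for q using assms by auto
  then show ?thesis unfolding avoids_def by blast
qed

lemma Av_eq_first_132_at:
  "Av [1,3,2] {[1,3,2],[2,1,3]} (p + 3) =
    {\<pi> \<in> permutations_of_set {1..p + 3}. first_132_at ((!) \<pi>) p}"
proof -
  have 1: "\<not> occurs_at [2,1,3] x p" if "occurs_at [1,3,2] x p" for x :: "nat \<Rightarrow> nat"
    using that unfolding occurs_at_132_iff occurs_at_213_iff by auto
  have 2: "[2,1,3] \<noteq> [1,3,2::nat]" by simp
  have 3: "(A p \<and> (\<forall>q. q \<le> p \<and> A q \<longrightarrow> q = p) \<and> (\<forall>q. \<not> (q \<le> p \<and> B q))) \<longleftrightarrow>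
      A p \<and> (\<forall>q. q + 3 \<le> p + 2 \<longrightarrow> \<not> A q \<and> \<not> B q)" if "A p \<Longrightarrow> \<not> B p" for A B :: "nat \<Rightarrow> bool"
  proof -
    have "q + 3 \<le> p + 2 \<longleftrightarrow> q \<le> p \<and> q \<noteq> p" for q by auto
    then show ?thesis using that by metis
  qed
  have "(occurs_in_at [1,3,2] \<pi> p \<and>
      (\<forall>\<sigma>\<in>{[1,3,2],[2,1,3]}. \<forall>q. occurs_in_at \<sigma> \<pi> q \<longrightarrow> \<sigma> = [1,3,2] \<and> q = p)) \<longleftrightarrow>
    first_132_at ((!) \<pi>) p" if "length \<pi> = p + 3" for \<pi> :: "nat list"
  proof -
    have A: "occurs_in_at [1,3,2] \<pi> q \<longleftrightarrow> q \<le> p \<and> occurs_at [1,3,2] ((!) \<pi>) q"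
      and B: "occurs_in_at [2,1,3] \<pi> q \<longleftrightarrow> q \<le> p \<and> occurs_at [2,1,3] ((!) \<pi>) q" for q
      unfolding occurs_in_at_def that by simp_all
    have "(\<forall>\<sigma>\<in>{[1,3,2],[2,1,3]}. \<forall>q. occurs_in_at \<sigma> \<pi> q \<longrightarrow> \<sigma> = [1,3,2] \<and> q = p) \<longleftrightarrow>
        (\<forall>q. occurs_in_at [1,3,2] \<pi> q \<longrightarrow> q = p) \<and> (\<forall>q. \<not> occurs_in_at [2,1,3] \<pi> q)"
      using 2 by simp
    then show ?thesis
      unfolding A B first_132_at_def avoids_def
      using 3[of "occurs_at [1,3,2] ((!) \<pi>)" "occurs_at [2,1,3] ((!) \<pi>)", OF 1] by simp
  qed
  note * = this
  have len: "p + 3 - length [1,3,2::nat] = p" by simp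
  show ?thesis
    unfolding Av_def len
    by (intro Collect_cong conj_cong refl *) (rule permutation_of_interval_nth(1))
qed

text \<open>The first two entries of a permutation are distinct, so leaving out the diagonal loses nothing.\<close>
lemma sum_start_count:
  assumes "2 \<le> n"
  shows "(\<Sum>i\<in>{1..n}. \<Sum>j\<in>{1..n} - {i}. start_count n i j) =
    card (Av [1,3,2] {[1,3,2],[2,1,3]} n)"
proof -
  let ?A = "Av [1,3,2] {[1,3,2],[2,1,3]} n" and ?I = "SIGMA i:{1..n}. {1..n} - {i}"
  let ?C = "\<lambda>z. {\<pi> \<in> ?A. \<pi> ! 0 = fst z \<and> \<pi> ! 1 = snd z}"
  have sub: "?A \<subseteq> permutations_of_set {1..n}" by (auto simp: Av_def)
  have fin: "finite ?A" by (rule finite_subset[OF sub]) simp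
  have "(\<pi> ! 0, \<pi> ! 1) \<in> ?I" if "\<pi> \<in> ?A" for \<pi>
  proof -
    note p = permutation_of_interval_nth[OF subsetD[OF sub that]]
    have "\<pi> ! 0 \<in> set \<pi>" "\<pi> ! 1 \<in> set \<pi>" using p(1) assms by auto
    moreover have "\<pi> ! 0 \<noteq> \<pi> ! 1" using p(1,2) assms by (simp add: nth_eq_iff_index_eq)
    ultimately show ?thesis using p(3) by auto
  qed
  then have "?A = (\<Union>z\<in>?I. ?C z)" by force
  then have "card ?A = card (\<Union>z\<in>?I. ?C z)" by simp
  also have "\<dots> = (\<Sum>z\<in>?I. card (?C z))"
    by (rule card_UN_disjoint) (use fin in auto)
  finally show ?thesis by (simp add: sum.Sigma start_count_def split_beta)
qed

section \<open>Counting avoiders by their last two entries\<close>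

text \<open>The permutation of \<open>{1..n + 1}\<close> which ends in \<open>k\<close> and whose first \<open>n\<close> entries are ordered
  like \<open>\<pi>\<close>.\<close>
definition append_rank :: "nat list \<Rightarrow> nat \<Rightarrow> nat list" where
  "append_rank \<pi> k = map (\<lambda>v. if v < k then v else Suc v) \<pi> @ [k]"

lemma append_rank_nth:
  assumes "length \<pi> = n"
  shows "length (append_rank \<pi> k) = Suc n" "append_rank \<pi> k ! n = k"
    and "i < n \<Longrightarrow> append_rank \<pi> k ! i = (if \<pi> ! i < k then \<pi> ! i else Suc (\<pi> ! i))"
  using assms by (auto simp: append_rank_def nth_append)

lemma append_rank_same_order:
  assumes "length \<pi> = n"
  shows "same_order n ((!) (append_rank \<pi> k)) ((!) \<pi>)"
  unfolding same_order_def by (auto simp: append_rank_nth[OF assms])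

lemma append_rank_in_permutations:
  assumes "\<pi> \<in> permutations_of_set {1..n}" "k \<in> {1..Suc n}"
  shows "append_rank \<pi> k \<in> permutations_of_set {1..Suc n}"
proof -
  let ?s = "\<lambda>v. if v < k then v else Suc v"
  note p = permutation_of_interval_nth[OF assms(1)]
  have inj: "inj ?s" by (auto simp: inj_on_def split: if_splits)
  have "?s ` {1..n} = {1..Suc n} - {k}"
  proof (intro equalityI subsetI)
    fix v assume v: "v \<in> {1..Suc n} - {k}"
    show "v \<in> ?s ` {1..n}"
    proof (cases "v < k")
      case True then show ?thesis using v assms(2) by (intro image_eqI[of _ _ v]) auto
    next
      case False then show ?thesis using v assms(2) by (intro image_eqI[of _ _ "v - 1"]) auto
    qed
  qed (use assms(2) in \<open>auto split: if_splits\<close>)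
  then show ?thesis
    using p assms(2) inj_on_subset[OF inj]
    by (auto simp: permutations_of_set_def append_rank_def distinct_map)
qed

lemma append_rank_inj: "append_rank \<pi> k = append_rank \<rho> k \<Longrightarrow> \<pi> = \<rho>"
proof -
  have "inj (\<lambda>v. if v < k then v else Suc v)" by (auto simp: inj_on_def split: if_splits)
  then show "append_rank \<pi> k = append_rank \<rho> k \<Longrightarrow> \<pi> = \<rho>"
    by (simp add: append_rank_def)
qed

lemma permutation_eq_append_rank:
  assumes "\<rho> \<in> permutations_of_set {1..Suc n}"
  obtains \<pi> where "\<pi> \<in> permutations_of_set {1..n}" "\<rho> = append_rank \<pi> (\<rho> ! n)"
proof -
  note p = permutation_of_interval_nth[OF assms]
  define k where "k = \<rho> ! n"
  let ?d = "\<lambda>v. if v < k then v else v - 1"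
  define \<pi> where "\<pi> = map ?d (butlast \<rho>)"
  have \<rho>: "\<rho> = butlast \<rho> @ [k]"
    using p(1) unfolding k_def by (metis append_butlast_last_id diff_Suc_1 last_conv_nth length_0_conv nat.distinct(1))
  have k: "k \<notin> set (butlast \<rho>)" "distinct (butlast \<rho>)" "k \<in> {1..Suc n}"
    using p(2) \<rho> p(3) by (metis distinct_append disjoint_iff list.set_intros(1),
        metis distinct_append, metis in_set_conv_decomp)
  have set: "set (butlast \<rho>) = {1..Suc n} - {k}"
    using p(3) \<rho> k(1) by (metis Diff_insert_absorb Un_insert_right list.simps(15) set_append set_empty2 sup_bot_right)
  have "?d ` ({1..Suc n} - {k}) = {1..n}"
  proof (intro equalityI subsetI)
    fix v assume v: "v \<in> {1..n}"
    show "v \<in> ?d ` ({1..Suc n} - {k})"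
    proof (cases "v < k")
      case True then show ?thesis using v by (intro image_eqI[of _ _ v]) auto
    next
      case False then show ?thesis using v by (intro image_eqI[of _ _ "Suc v"]) auto
    qed
  qed (use k(3) in \<open>auto split: if_splits\<close>)
  moreover have "inj_on ?d ({1..Suc n} - {k})"
    by (auto simp: inj_on_def split: if_splits)
  ultimately have "\<pi> \<in> permutations_of_set {1..n}"
    using k(2) set by (auto simp: permutations_of_set_def \<pi>_def distinct_map)
  moreover have "map (\<lambda>v. if v < k then v else Suc v) \<pi> = butlast \<rho>"
  proof -
    have "(\<lambda>v. if v < k then v else Suc v) (?d x) = x" if "x \<in> set (butlast \<rho>)" for x
    proof -
      have "x \<noteq> k" "1 \<le> x" using that set by simp_all
      then show ?thesis by (cases "x < k") auto
    qed
    then show ?thesis unfolding \<pi>_def map_map by (intro map_idI) (simp add: comp_def)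
  qed
  then have "\<rho> = append_rank \<pi> k" using \<rho> by (simp add: append_rank_def)
  ultimately show ?thesis using that by (simp add: k_def)
qed

text \<open>Here and in all counts below, values are shifted to start at 0, so that they can serve as list
  indices: the last two entries of a member are \<open>i + 1\<close> and \<open>j + 1\<close>.\<close>
definition ending :: "nat \<Rightarrow> nat \<Rightarrow> nat \<Rightarrow> nat list set" where
  "ending m i j = {\<pi> \<in> avoiders (m + 2). \<pi> ! m = Suc i \<and> \<pi> ! (m + 1) = Suc j}"

lemma finite_avoiders [simp]: "finite (avoiders n)"
  by (rule finite_subset[of _ "permutations_of_set {1..n}"]) (auto simp: avoiders_def)

lemma finite_ending [simp]: "finite (ending m i j)"
  by (rule finite_subset[of _ "avoiders (m + 2)"]) (auto simp: ending_def)

lemma last_entries: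
  assumes "\<pi> \<in> permutations_of_set {1..m + 2}"
  obtains i j where "i < m + 2" "j < m + 2" "i \<noteq> j" "\<pi> ! m = Suc i" "\<pi> ! (m + 1) = Suc j"
proof -
  note p = permutation_of_interval_nth[OF assms]
  have "\<pi> ! m \<in> set \<pi>" "\<pi> ! (m + 1) \<in> set \<pi>" using p(1) by auto
  moreover have "\<pi> ! m \<noteq> \<pi> ! (m + 1)" using p(1,2) by (simp add: nth_eq_iff_index_eq)
  ultimately show ?thesis
    using p(3) by (intro that[of "\<pi> ! m - 1" "\<pi> ! (m + 1) - 1"]) auto
qed

lemma ending_diagonal: "ending m i i = {}"
proof (intro equals0I)
  fix \<pi> assume \<pi>: "\<pi> \<in> ending m i i"
  then have "\<pi> \<in> permutations_of_set {1..m + 2}" by (auto simp: ending_def avoiders_def)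
  from last_entries[OF this] show False using \<pi> by (auto simp: ending_def)
qed

text \<open>Appending \<open>k + 1\<close> raises exactly the earlier entries that are at least \<open>k + 1\<close>; this accounts for
  \<open>k \<le> j\<close> in place of \<open>k < j\<close>.\<close>
lemma occurs_at_append_rank:
  assumes "length \<pi> = m + 2" "\<pi> ! m = Suc i" "\<pi> ! (m + 1) = Suc j"
  shows "occurs_at [1,3,2] ((!) (append_rank \<pi> (Suc k))) m \<longleftrightarrow> i < k \<and> k \<le> j"
    and "occurs_at [2,1,3] ((!) (append_rank \<pi> (Suc k))) m \<longleftrightarrow> j < i \<and> i < k"
  using assms append_rank_nth(2)[OF assms(1)]
  unfolding occurs_at_132_iff occurs_at_213_iff by (auto simp: append_rank_nth(3)[OF assms(1)])

text \<open>The common part of the two counts below: which permutations may be extended by a given last entry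
  depends on their last two entries only, here through \<open>R\<close>. The condition \<open>Q\<close> on the
  extended permutation will be avoidance for \<open>pair_count_Suc\<close>, and an occurrence of 132 at the end
  for \<open>card_Av\<close>.\<close>
lemma card_extensions:
  assumes Q: "\<And>\<pi> i j. \<pi> \<in> ending m i j \<Longrightarrow> i < m + 2 \<Longrightarrow> j < m + 2 \<Longrightarrow>
      Q (append_rank \<pi> (Suc k)) \<longleftrightarrow> (i, j) \<in> R"
    and R: "R \<subseteq> {..<m + 2} \<times> {..<m + 2}" and k: "k < m + 3"
  shows "card {\<rho> \<in> permutations_of_set {1..m + 3}. \<rho> ! (m + 2) = Suc k \<and>
      avoids (m + 2) ((!) \<rho>) \<and> Q \<rho>} = (\<Sum>(i, j)\<in>R. card (ending m i j))" (is "card ?A = _")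
proof -
  let ?a = "\<lambda>\<pi>. append_rank \<pi> (Suc k)" and ?U = "\<Union>(i, j)\<in>R. ending m i j"
  have av: "avoids (m + 2) ((!) (append_rank \<pi> c)) \<longleftrightarrow> avoids (m + 2) ((!) \<pi>)"
    if "\<pi> \<in> permutations_of_set {1..m + 2}" for \<pi> c
    using same_order_avoids[OF append_rank_same_order[OF permutation_of_interval_nth(1)[OF that]] order_refl] .
  have "?A = ?a ` ?U"
  proof (intro equalityI subsetI)
    fix \<rho> assume \<rho>: "\<rho> \<in> ?A"
    then have "\<rho> \<in> permutations_of_set {1..Suc (m + 2)}" by (simp add: eval_nat_numeral)
    from permutation_eq_append_rank[OF this] obtain \<pi>
      where \<pi>: "\<pi> \<in> permutations_of_set {1..m + 2}" "\<rho> = ?a \<pi>" using \<rho> by auto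
    from last_entries[OF \<pi>(1)] obtain i j
      where ij: "i < m + 2" "j < m + 2" "\<pi> ! m = Suc i" "\<pi> ! (m + 1) = Suc j" by blast
    have "\<pi> \<in> ending m i j" using \<rho> \<pi> ij av by (simp add: ending_def avoiders_def)
    moreover from this have "(i, j) \<in> R" using Q ij \<rho> \<pi> by blast
    ultimately show "\<rho> \<in> ?a ` ?U" using \<pi>(2) by blast
  next
    fix \<rho> assume "\<rho> \<in> ?a ` ?U"
    then obtain \<pi> i j where *: "\<rho> = ?a \<pi>" "(i, j) \<in> R" "\<pi> \<in> ending m i j" by auto
    then have \<pi>: "\<pi> \<in> permutations_of_set {1..m + 2}" "avoids (m + 2) ((!) \<pi>)"
      by (auto simp: ending_def avoiders_def)
    have "\<rho> \<in> permutations_of_set {1..Suc (m + 2)}"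
      unfolding * using \<pi>(1) k by (intro append_rank_in_permutations) auto
    moreover have "Q \<rho>" using * Q R by blast
    ultimately show "\<rho> \<in> ?A"
      using * \<pi> av append_rank_nth(2)[OF permutation_of_interval_nth(1)[OF \<pi>(1)]]
      by (simp add: eval_nat_numeral)
  qed
  then have "card ?A = card ?U"
    by (simp add: card_image inj_on_def append_rank_inj)
  also have "\<dots> = (\<Sum>z\<in>R. card (case z of (i, j) \<Rightarrow> ending m i j))"
    by (rule card_UN_disjoint) (use finite_subset[OF R] in \<open>auto simp: ending_def\<close>)
  finally show ?thesis by (simp add: case_prod_unfold)
qed

definition pair_count :: "nat \<Rightarrow> nat \<Rightarrow> nat \<Rightarrow> int" where
  "pair_count m i j = int (card (ending m i j))"

definition pair_tail :: "nat \<Rightarrow> nat \<Rightarrow> nat \<Rightarrow> int" where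
  "pair_tail m j k = (\<Sum>i=k..<m + 2. pair_count m i j)"

lemma sum_below_eq_tails:
  "k \<le> m + 2 \<Longrightarrow> (\<Sum>i<k. pair_count m i j) = pair_tail m j 0 - pair_tail m j k"
  using sum.atLeastLessThan_concat[of 0 k "m + 2" "\<lambda>i. pair_count m i j"]
  by (simp add: pair_tail_def atLeast0LessThan)

lemma ending_Suc:
  "ending (Suc m) j k = {\<rho> \<in> permutations_of_set {1..m + 3}. \<rho> ! (m + 2) = Suc k \<and>
      avoids (m + 2) ((!) \<rho>) \<and> \<not> occurs_at [1,3,2] ((!) \<rho>) m \<and> \<not> occurs_at [2,1,3] ((!) \<rho>) m \<and>
      \<rho> ! (m + 1) = Suc j}"
  using avoids_Suc[of "m + 2"] by (auto simp: ending_def avoiders_def eval_nat_numeral)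

text \<open>If the avoider ends in \<open>j, k\<close>, delete \<open>k\<close> and let \<open>i\<close> be the rank of the entry before \<open>j\<close> in the
  shorter permutation. For \<open>j < k\<close> the pattern 213 excludes \<open>j < i < k\<close>. For \<open>j > k\<close> the entry \<open>j\<close>
  drops to \<open>j - 1\<close> upon deletion, and 132 excludes \<open>i < k\<close>. In both cases the admissible \<open>i\<close>
  form at most two intervals, so tails suffice.\<close>
lemma pair_count_Suc:
  assumes "j < m + 3" "k < m + 3"
  shows "pair_count (Suc m) j k =
    (if j = k then 0
     else if j < k then pair_tail m j 0 - pair_tail m j j + pair_tail m j k
     else pair_tail m (j - 1) k)"
proof (cases "j = k")
  case True then show ?thesis by (simp add: pair_count_def ending_diagonal)
next
  case False
  define j' where "j' = (if j < k then j else j - 1)"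
  define I where "I = {i. i < m + 2 \<and> \<not> (i < k \<and> k \<le> j') \<and> \<not> (j' < i \<and> i < k)}"
  have "int (card (ending (Suc m) j k)) = int (\<Sum>(i, j)\<in>I \<times> {j'}. card (ending m i j))"
    unfolding ending_Suc
  proof (subst card_extensions[where R = "I \<times> {j'}"])
    fix \<pi> i l assume \<pi>: "\<pi> \<in> ending m i l" and il: "i < m + 2" "l < m + 2"
    then have *: "length \<pi> = m + 2" "\<pi> ! m = Suc i" "\<pi> ! (m + 1) = Suc l"
      by (auto simp: ending_def avoiders_def permutation_of_interval_nth(1))
    have "append_rank \<pi> (Suc k) ! (m + 1) = Suc j \<longleftrightarrow> l = j'"
      using append_rank_nth(3)[OF *(1), of "m + 1"] *(3) False unfolding j'_def by auto
    then show "(\<not> occurs_at [1,3,2] ((!) (append_rank \<pi> (Suc k))) m \<and>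
        \<not> occurs_at [2,1,3] ((!) (append_rank \<pi> (Suc k))) m \<and>
        append_rank \<pi> (Suc k) ! (m + 1) = Suc j) \<longleftrightarrow> (i, l) \<in> I \<times> {j'}"
      unfolding occurs_at_append_rank[OF *] using il by (auto simp: I_def)
  qed (use assms False in \<open>auto simp: I_def j'_def\<close>)
  then have eq: "pair_count (Suc m) j k = (\<Sum>i\<in>I. pair_count m i j')"
    by (simp add: pair_count_def sum.cartesian_product[symmetric])
  show ?thesis
  proof (cases "j < k")
    case True
    then have "I = ({..<j} \<union> {k..<m + 2}) \<union> {j}"
      using assms by (auto simp: I_def j'_def)
    then have "pair_count (Suc m) j k = (\<Sum>i\<in>{..<j} \<union> {k..<m + 2}. pair_count m i j)"
      unfolding eq using True by (simp add: j'_def sum.union_disjoint pair_count_def ending_diagonal)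
    also have "\<dots> = (\<Sum>i<j. pair_count m i j) + pair_tail m j k"
      unfolding pair_tail_def using True by (intro sum.union_disjoint) auto
    also have "(\<Sum>i<j. pair_count m i j) = pair_tail m j 0 - pair_tail m j j"
      using True assms by (intro sum_below_eq_tails) auto
    finally show ?thesis using True by simp
  next
    case False
    then have "I = {k..<m + 2}" using \<open>j \<noteq> k\<close> by (auto simp: I_def j'_def)
    then show ?thesis unfolding eq pair_tail_def using False \<open>j \<noteq> k\<close> by (simp add: j'_def)
  qed
qed

text \<open>A member of \<open>Av\<close> is an avoider, ending in \<open>i, j\<close>, extended by a value \<open>k\<close> with \<open>i < k \<le> j\<close>.\<close>
lemma card_Av:
  "int (card (Av [1,3,2] {[1,3,2],[2,1,3]} (m + 3))) =
    (\<Sum>k<m + 2. \<Sum>j=k..<m + 2. pair_tail m j 0 - pair_tail m j k)"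
proof -
  let ?A = "\<lambda>k. {\<rho> \<in> permutations_of_set {1..m + 3}. \<rho> ! (m + 2) = Suc k \<and>
      avoids (m + 2) ((!) \<rho>) \<and> occurs_at [1,3,2] ((!) \<rho>) m}"
  have "\<exists>k<m + 3. \<rho> ! (m + 2) = Suc k" if "\<rho> \<in> permutations_of_set {1..m + 3}" for \<rho>
  proof -
    note p = permutation_of_interval_nth[OF that]
    have "\<rho> ! (m + 2) \<in> set \<rho>" using p(1) by simp
    with p(3) show ?thesis by (intro exI[of _ "\<rho> ! (m + 2) - 1"]) auto
  qed
  then have "Av [1,3,2] {[1,3,2],[2,1,3]} (m + 3) = (\<Union>k\<in>{..<m + 3}. ?A k)"
    unfolding Av_eq_first_132_at first_132_at_def by auto
  then have "card (Av [1,3,2] {[1,3,2],[2,1,3]} (m + 3)) = card (\<Union>k\<in>{..<m + 3}. ?A k)" by simp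
  also have "\<dots> = (\<Sum>k<m + 3. card (?A k))"
    by (rule card_UN_disjoint) auto
  finally have "int (card (Av [1,3,2] {[1,3,2],[2,1,3]} (m + 3))) = (\<Sum>k<m + 3. int (card (?A k)))"
    by simp
  also have "\<dots> = (\<Sum>k<m + 3. \<Sum>j=k..<m + 2. pair_tail m j 0 - pair_tail m j k)"
  proof (rule sum.cong[OF refl])
    fix k assume k: "k \<in> {..<m + 3}"
    have "card (?A k) = (\<Sum>(i, j)\<in>{..<k} \<times> {k..<m + 2}. card (ending m i j))"
    proof (rule card_extensions)
      fix \<pi> i j assume "\<pi> \<in> ending m i j" "i < m + 2" "j < m + 2"
      then have *: "length \<pi> = m + 2" "\<pi> ! m = Suc i" "\<pi> ! (m + 1) = Suc j" "j < m + 2"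
        by (auto simp: ending_def avoiders_def permutation_of_interval_nth(1))
      then show "occurs_at [1,3,2] ((!) (append_rank \<pi> (Suc k))) m \<longleftrightarrow> (i, j) \<in> {..<k} \<times> {k..<m + 2}"
        unfolding occurs_at_append_rank[OF *(1-3)] by auto
    qed (use k in auto)
    also have "\<dots> = (\<Sum>j=k..<m + 2. \<Sum>i<k. card (ending m i j))"
      by (subst sum.cartesian_product[symmetric], rule sum.swap)
    finally have "int (card (?A k)) = (\<Sum>j=k..<m + 2. \<Sum>i<k. pair_count m i j)"
      by (simp add: pair_count_def)
    then show "int (card (?A k)) = (\<Sum>j=k..<m + 2. pair_tail m j 0 - pair_tail m j k)"
      using k by (simp add: sum_below_eq_tails)
  qed
  \<comment> \<open>The largest value \<open>k = m + 2\<close> cannot end a 132.\<close>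
  also have "\<dots> = (\<Sum>k<m + 2. \<Sum>j=k..<m + 2. pair_tail m j 0 - pair_tail m j k)"
    by (simp add: eval_nat_numeral)
  finally show ?thesis .
qed

lemma card_avoiders: "int (card (avoiders (m + 2))) = (\<Sum>j<m + 2. pair_tail m j 0)"
proof -
  let ?I = "{..<m + 2} \<times> {..<m + 2}"
  have "avoiders (m + 2) = (\<Union>(j, i)\<in>?I. ending m i j)"
  proof (intro equalityI subsetI)
    fix \<pi> assume \<pi>: "\<pi> \<in> avoiders (m + 2)"
    then have "\<pi> \<in> permutations_of_set {1..m + 2}" by (simp add: avoiders_def)
    from last_entries[OF this] obtain i j
      where "i < m + 2" "j < m + 2" "\<pi> ! m = Suc i" "\<pi> ! (m + 1) = Suc j" by blast
    then show "\<pi> \<in> (\<Union>(j, i)\<in>?I. ending m i j)" using \<pi>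
      by (intro UN_I[of "(j, i)"]) (auto simp: ending_def)
  qed (auto simp: ending_def)
  then have "card (avoiders (m + 2)) = card (\<Union>(j, i)\<in>?I. ending m i j)" by simp
  also have "\<dots> = (\<Sum>z\<in>?I. card (case z of (j, i) \<Rightarrow> ending m i j))"
    by (rule card_UN_disjoint) (auto simp: ending_def)
  also have "\<dots> = (\<Sum>j<m + 2. \<Sum>i<m + 2. card (ending m i j))"
    unfolding sum.cartesian_product by (intro sum.cong) auto
  finally show ?thesis by (simp add: pair_tail_def pair_count_def atLeast0LessThan)
qed

lemma pair_count_0:
  assumes "i < 2" "j < 2"
  shows "pair_count 0 i j = (if i = j then 0 else 1)"
proof (cases "i = j")
  case True then show ?thesis by (simp add: pair_count_def ending_diagonal)
next
  case False
  have "ending 0 i j = {[Suc i, Suc j]}"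
  proof (intro equalityI subsetI)
    fix \<pi> assume "\<pi> \<in> ending 0 i j"
    then have "length \<pi> = 2" "\<pi> ! 0 = Suc i" "\<pi> ! 1 = Suc j"
      by (auto simp: ending_def avoiders_def permutation_of_interval_nth(1))
    then show "\<pi> \<in> {[Suc i, Suc j]}" by (auto simp: length_Suc_conv eval_nat_numeral)
  next
    fix \<pi> assume "\<pi> \<in> {[Suc i, Suc j]}"
    moreover have "{Suc i, Suc j} = {1..2}" using assms False by auto
    ultimately show "\<pi> \<in> ending 0 i j"
      using False by (auto simp: ending_def avoiders_def permutations_of_set_def avoids_def)
  qed
  then show ?thesis using False by (simp add: pair_count_def)
qed

section \<open>Computing the counts up to length 23\<close>

primrec suffix_sums :: "int list \<Rightarrow> int list" where
  "suffix_sums [] = [0]"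
| "suffix_sums (x # xs) = (let s = suffix_sums xs in (x + hd s) # s)"

lemma suffix_sums_nonempty: "suffix_sums xs \<noteq> []"
  by (induction xs) (auto simp: Let_def)

lemma suffix_sums_nth:
  "k \<le> length xs \<Longrightarrow> suffix_sums xs ! k = (\<Sum>i=k..<length xs. xs ! i)"
proof (induction xs arbitrary: k)
  case (Cons x xs)
  have "hd (suffix_sums xs) = (\<Sum>i=0..<length xs. xs ! i)"
    using Cons.IH[of 0] suffix_sums_nonempty by (simp add: hd_conv_nth)
  then show ?case
    using Cons by (cases k) (auto simp: Let_def sum.atLeast_Suc_lessThan sum.shift_bounds_Suc_ivl
        simp del: sum.op_ivl_Suc)
qed simp

text \<open>Adds a row on top of a matrix that is stored by columns of suffix sums: folding it over the rows
  of a matrix transposes the matrix and sums its columns from below in one pass.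

  This function and the ones that follow are shaped for evaluation by the simplifier: they recurse
  along the lists and never substitute a whole table into an abstraction, where it would be
  traversed again for each entry.\<close>
primrec push_row :: "int list \<Rightarrow> int list list \<Rightarrow> int list list" where
  "push_row [] cs = []"
| "push_row (x # xs) cs = ((x + hd (hd cs)) # hd cs) # push_row xs (tl cs)"

text \<open>One row of the recurrence \<open>pair_count_Suc\<close>, for fixed \<open>j\<close> and all \<open>k\<close>: \<open>c\<close> holds the tails for
  \<open>j\<close> and \<open>p\<close> those for \<open>j - 1\<close>.\<close>
definition extension_row :: "nat \<Rightarrow> int list \<Rightarrow> int list \<Rightarrow> int list" where
  "extension_row j p c = take j p @ 0 # map ((+) (hd c - c ! j)) (drop (Suc j) c)"

text \<open>The rows for \<open>j, j + 1, \<dots>\<close>. The last row has no column \<open>c\<close> of its own, as the new largest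
  value \<open>j\<close> is only ever followed by smaller ones.\<close>
primrec extension_rows :: "nat \<Rightarrow> int list \<Rightarrow> int list list \<Rightarrow> int list list" where
  "extension_rows j p [] = [take j p @ [0]]"
| "extension_rows j p (c # cs) = extension_row j p c # extension_rows (Suc j) c cs"

text \<open>The number of ways to finish with 132, summed by columns: column \<open>j\<close> contributes
  for each \<open>k \<le> j\<close> the number of avoiders with \<open>i < k\<close>.\<close>
primrec completions :: "nat \<Rightarrow> int list list \<Rightarrow> int" where
  "completions j [] = 0"
| "completions j (c # cs) = int (Suc j) * hd c - sum_list (take (Suc j) c) + completions (Suc j) cs"

primrec tally_step :: "nat \<Rightarrow> int \<times> int list list \<Rightarrow> int \<times> int list list" where
  "tally_step n (a, S) = (int (Suc n) * a + completions 0 S,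
     foldr push_row (extension_rows 0 [] S) (replicate (Suc n) [0]))"

text \<open>The second component lists the tails \<open>pair_tail m j\<close> for all \<open>j\<close>. The first is the partial sum of
  the probabilities up to length \<open>n = m + 2\<close>, multiplied by \<open>n!\<close> to keep it an integer. For
  \<open>m = 0\<close> these are the tails of the two permutations of length 2.\<close>
primrec tally :: "nat \<Rightarrow> int \<times> int list list" where
  "tally 0 = (0, [[1, 1, 0], [1, 0, 0]])"
| "tally (Suc m) = tally_step (m + 2) (tally m)"

lemma foldr_push_row:
  assumes "\<forall>r\<in>set rs. length r = N"
  shows "foldr push_row rs (replicate N [0]) = map (\<lambda>k. suffix_sums (map (\<lambda>r. r ! k) rs)) [0..<N]"
  using assms
proof (induction rs)
  case Nil
  then show ?case by (simp add: map_replicate_const)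
next
  case (Cons r rs)
  have push: "push_row xs (map f [a..<b]) = map (\<lambda>k. (xs ! (k - a) + hd (f k)) # f k) [a..<b]"
    if "length xs = b - a" "a \<le> b" for xs f a b
    using that
  proof (induction xs arbitrary: a)
    case (Cons x xs)
    then have "a < b" by simp
    then have "[a..<b] = a # [Suc a..<b]" by (rule upt_conv_Cons)
    moreover have "(x # xs) ! (k - a) = xs ! (k - Suc a)" if "k \<in> set [Suc a..<b]" for k
      using that by (simp add: nth_Cons')
    ultimately show ?case using Cons.prems Cons.IH[of "Suc a"] by (auto intro!: map_cong)
  qed simp
  show ?case using Cons push[of r N 0] by (simp add: Let_def)
qed

lemma extension_row_nth:
  assumes "length c = N" "j < N" "length p = N" "k < N"
  shows "length (extension_row j p c) = N"
    and "extension_row j p c ! k = (if k < j then p ! k else if k = j then 0 else c ! 0 - c ! j + c ! k)"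
proof -
  have "hd c = c ! 0" using assms by (intro hd_conv_nth) auto
  then show "extension_row j p c ! k = (if k < j then p ! k else if k = j then 0 else c ! 0 - c ! j + c ! k)"
    using assms by (auto simp: extension_row_def nth_append nth_Cons')
  show "length (extension_row j p c) = N" using assms by (simp add: extension_row_def)
qed

lemma extension_rows_nth:
  "length (extension_rows j p cs) = Suc (length cs)"
  "i \<le> length cs \<Longrightarrow> extension_rows j p cs ! i =
    (if i < length cs then extension_row (j + i) ((p # cs) ! i) (cs ! i) else take (j + i) ((p # cs) ! i) @ [0])"
proof (induction cs arbitrary: j p i)
  case (Cons c cs)
  { case 1 show ?case using Cons.IH(1) by simp
  next
    case 2 then show ?case using Cons.IH(2)[of "i - 1" "Suc j" c] by (cases i) auto
  }
qed auto

lemma completions_eq: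
  "\<forall>c\<in>set cs. c \<noteq> [] \<and> j + length cs \<le> length c \<Longrightarrow>
    completions j cs = (\<Sum>i<length cs. \<Sum>k\<le>j + i. (cs ! i) ! 0 - (cs ! i) ! k)"
proof (induction cs arbitrary: j)
  case (Cons c cs)
  have "sum_list (take (Suc j) c) = (\<Sum>k\<le>j. c ! k)"
    using Cons.prems by (simp add: sum_list_sum_nth atLeast0LessThan lessThan_Suc_atMost)
  moreover have "hd c = c ! 0" using Cons.prems by (intro hd_conv_nth) auto
  ultimately have "int (Suc j) * hd c - sum_list (take (Suc j) c) = (\<Sum>k\<le>j. c ! 0 - c ! k)"
    by (simp add: sum_subtractf)
  then show ?case using Cons by (simp add: sum.lessThan_Suc_shift del: sum.lessThan_Suc sum.atMost_Suc)
qed simp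

lemma tally_tails:
  "snd (tally m) = map (\<lambda>j. map (pair_tail m j) [0..<m + 3]) [0..<m + 2]"
proof (induction m)
  case 0
  have "[0..<0 + 3] = [0, 1, 2::nat]" "[0..<0 + 2] = [0, 1::nat]" by (simp_all add: upt_rec)
  moreover have "{0..<0 + 2::nat} = {0, 1}" "{1..<0 + 2::nat} = {1}" "{2..<0 + 2::nat} = {}" by auto
  ultimately show ?case by (simp add: pair_tail_def pair_count_0)
next
  case (Suc m)
  define S where "S = map (\<lambda>j. map (pair_tail m j) [0..<m + 3]) [0..<m + 2]"
  have S: "length S = m + 2" "\<And>j. j < m + 2 \<Longrightarrow> length (S ! j) = m + 3"
      "\<And>j k. j < m + 2 \<Longrightarrow> k < m + 3 \<Longrightarrow> S ! j ! k = pair_tail m j k"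
    unfolding S_def by (simp_all del: upt_Suc)
  have len: "length (extension_rows 0 [] S) = m + 3" using extension_rows_nth(1)[of 0 "[]" S] S(1) by simp
  have rows: "length (extension_rows 0 [] S ! j) = m + 3 \<and>
      (k < m + 3 \<longrightarrow> extension_rows 0 [] S ! j ! k = pair_count (Suc m) j k)" if "j < m + 3" for j k
  proof -
    consider "j = 0" | "0 < j" "j < m + 2" | "j = m + 2" using \<open>j < m + 3\<close> by linarith
    then show ?thesis
    proof cases
      case 1
      then have "extension_rows 0 [] S ! j = 0 # map ((+) (hd (S ! 0) - S ! 0 ! 0)) (drop 1 (S ! 0))"
        using extension_rows_nth(2)[of 0 S 0 "[]"] S(1) by (simp add: extension_row_def)
      moreover have "hd (S ! 0) = S ! 0 ! 0" using S(2)[of 0] by (intro hd_conv_nth) auto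
      ultimately show ?thesis using S 1 by (auto simp: pair_count_Suc nth_Cons')
    next
      case 2
      then have *: "extension_rows 0 [] S ! j = extension_row j (S ! (j - 1)) (S ! j)"
        using extension_rows_nth(2)[of j S 0 "[]"] S(1) by (simp add: nth_Cons')
      note r = extension_row_nth[of "S ! j" "m + 3" j "S ! (j - 1)", OF S(2)[OF 2(2)] _ S(2)]
      show ?thesis unfolding *
        using 2 r(1)[of 0] r(2)[of k] S(3) by (auto simp: pair_count_Suc)
    next
      case 3
      then have "extension_rows 0 [] S ! j = take j (S ! (j - 1)) @ [0]"
        using extension_rows_nth(2)[of j S 0 "[]"] S(1) by (simp add: nth_Cons')
      then show ?thesis using 3 S by (auto simp: pair_count_Suc nth_append)
    qed
  qed
  have "snd (tally (Suc m)) = foldr push_row (extension_rows 0 [] S) (replicate (m + 3) [0])"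
    using Suc.IH unfolding S_def[symmetric] by (cases "tally m") (simp add: eval_nat_numeral)
  also have "\<dots> = map (\<lambda>k. suffix_sums (map (\<lambda>r. r ! k) (extension_rows 0 [] S))) [0..<m + 3]"
    by (rule foldr_push_row) (use rows len in \<open>auto simp: in_set_conv_nth\<close>)
  also have "\<dots> = map (\<lambda>k. map (pair_tail (Suc m) k) [0..<Suc m + 3]) [0..<m + 3]"
  proof (rule map_cong[OF refl])
    fix k assume "k \<in> set [0..<m + 3]"
    then have k: "k < m + 3" by simp
    have "map (\<lambda>r. r ! k) (extension_rows 0 [] S) = map (\<lambda>j. pair_count (Suc m) j k) [0..<m + 3]"
      using rows k len by (intro nth_equalityI) (simp_all del: upt_Suc)
    moreover have "length (suffix_sums xs) = Suc (length xs)" for xs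
      by (induction xs) (auto simp: Let_def)
    ultimately show "suffix_sums (map (\<lambda>r. r ! k) (extension_rows 0 [] S)) = map (pair_tail (Suc m) k) [0..<Suc m + 3]"
      by (intro nth_equalityI) (simp_all add: suffix_sums_nth pair_tail_def numeral_3_eq_3 del: upt_Suc sum.op_ivl_Suc)
  qed
  also have "m + 3 = Suc m + 2" by simp
  finally show ?case .
qed

lemma completions_tally:
  "completions 0 (snd (tally m)) = int (card (Av [1,3,2] {[1,3,2],[2,1,3]} (m + 3)))"
proof -
  have "completions 0 (snd (tally m)) = (\<Sum>j<m + 2. \<Sum>k\<le>j. pair_tail m j 0 - pair_tail m j k)"
    unfolding tally_tails by (subst completions_eq) (auto simp del: upt_Suc)
  also have "\<dots> = (\<Sum>k<m + 2. \<Sum>j=k..<m + 2. pair_tail m j 0 - pair_tail m j k)"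
    by (subst sum.Sigma, simp, simp, subst sum.Sigma, simp, simp,
        rule sum.reindex_bij_witness[of _ prod.swap prod.swap]) auto
  finally show ?thesis by (simp only: card_Av)
qed

lemma tally_avoiders: "(\<Sum>c\<leftarrow>snd (tally m). hd c) = int (card (avoiders (m + 2)))"
proof -
  have "(\<Sum>c\<leftarrow>snd (tally m). hd c) = (\<Sum>j\<leftarrow>[0..<m + 2]. pair_tail m j 0)"
    unfolding tally_tails by (simp add: comp_def hd_map del: upt_Suc)
  then show ?thesis
    unfolding card_avoiders by (simp only: sum_list_distinct_conv_sum_set distinct_upt set_upt atLeast0LessThan)
qed

definition Av_partial_sum :: "nat \<Rightarrow> real" where
  "Av_partial_sum m = (\<Sum>p<m. card (Av [1,3,2] {[1,3,2],[2,1,3]} (p + 3)) / fact (p + 3))"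

lemma tally_partial_sum: "real_of_int (fst (tally m)) = fact (m + 2) * Av_partial_sum m"
proof (induction m)
  case 0 then show ?case by (simp add: Av_partial_sum_def)
next
  case (Suc m)
  have "fst (tally (Suc m)) = int (m + 3) * fst (tally m) + int (card (Av [1,3,2] {[1,3,2],[2,1,3]} (m + 3)))"
    using completions_tally[of m] by (cases "tally m") (simp add: eval_nat_numeral)
  then have "real_of_int (fst (tally (Suc m))) =
      real (m + 3) * real_of_int (fst (tally m)) + card (Av [1,3,2] {[1,3,2],[2,1,3]} (m + 3))"
    by simp
  also have "\<dots> = fact (m + 3) * Av_partial_sum (Suc m)"
    using fact_Suc[of "m + 2", where 'a = real] unfolding Suc.IH
    by (simp add: Av_partial_sum_def distrib_left numeral_3_eq_3 mult.assoc)
  finally show ?case by (simp add: eval_nat_numeral)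
qed

text \<open>The large numeral is \<open>23!\<close>.\<close>
lemma tally_21_bounds:
  "case tally 21 of (a, S) \<Rightarrow>
    4605 * 25852016738884976640000 < 10000 * a \<and>
    10000 * (a + (\<Sum>c\<leftarrow>S. hd c)) < 4615 * 25852016738884976640000"
  by code_simp

lemma numeric_bounds:
  "0.4605 < Av_partial_sum 21"
  "Av_partial_sum 21 + card (avoiders 23) / fact 23 < 0.4615"
proof -
  define a where "a = fst (tally 21)"
  have f: "fact 23 = (25852016738884976640000::real)" by (simp add: fact_numeral)
  have "real_of_int a = fact 23 * Av_partial_sum 21"
    unfolding a_def tally_partial_sum by simp
  moreover have "4605 * 25852016738884976640000 < 10000 * a" and
    "10000 * (a + int (card (avoiders 23))) < 4615 * 25852016738884976640000"
    using tally_21_bounds tally_avoiders[of 21] unfolding a_def by (simp_all add: split_beta)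
  then have "real_of_int (4605 * 25852016738884976640000) < real_of_int (10000 * a)" and
    "real_of_int (10000 * (a + int (card (avoiders 23)))) < real_of_int (4615 * 25852016738884976640000)"
    by (simp_all only: of_int_less_iff)
  ultimately show "0.4605 < Av_partial_sum 21"
    "Av_partial_sum 21 + card (avoiders 23) / fact 23 < 0.4615"
    unfolding f by (simp_all add: field_simps)
qed

section \<open>The probability that 132 comes first\<close>

lemma first_occurrence_less_iff:
  "first_occurrence \<sigma> x < first_occurrence \<tau> x \<longleftrightarrow>
    (\<exists>p. occurs_at \<sigma> x p \<and> (\<forall>q\<le>p. \<not> occurs_at \<tau> x q))"
proof -
  have "first_occurrence \<sigma> x < first_occurrence \<tau> x \<longleftrightarrow>
      (\<exists>p. occurs_at \<sigma> x p \<and> enat p < first_occurrence \<tau> x)"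
    unfolding first_occurrence_def[of \<sigma>] by (auto simp: INF_less_iff)
  also have "\<dots> \<longleftrightarrow> (\<exists>p. occurs_at \<sigma> x p \<and> enat (Suc p) \<le> first_occurrence \<tau> x)"
    by (simp add: Suc_ile_eq)
  also have "\<dots> \<longleftrightarrow> (\<exists>p. occurs_at \<sigma> x p \<and> (\<forall>q. occurs_at \<tau> x q \<longrightarrow> Suc p \<le> q))"
    unfolding first_occurrence_def by (simp add: le_INF_iff)
  finally show ?thesis by (metis not_less_eq_eq)
qed

text \<open>The earliest occurrence of 132 is the witness.\<close>
lemma first_132_before_213_iff:
  "first_occurrence [1,3,2] x < first_occurrence [2,1,3] x \<longleftrightarrow> (\<exists>p. first_132_at x p)"
proof -
  have avoids: "avoids (p + 2) x \<longleftrightarrow> (\<forall>q<p. \<not> occurs_at [1,3,2] x q \<and> \<not> occurs_at [2,1,3] x q)" for p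
    unfolding avoids_def by (intro all_cong1) auto
  have clash: "\<not> occurs_at [2,1,3] x p" if "occurs_at [1,3,2] x p" for p
    using that unfolding occurs_at_132_iff occurs_at_213_iff by auto
  show ?thesis
    unfolding first_occurrence_less_iff
  proof (intro iffI; elim exE)
    fix p assume p: "occurs_at [1,3,2] x p \<and> (\<forall>q\<le>p. \<not> occurs_at [2,1,3] x q)"
    define l where "l = (LEAST q. occurs_at [1,3,2] x q)"
    have "occurs_at [1,3,2] x l" "l \<le> p" "\<forall>q<l. \<not> occurs_at [1,3,2] x q"
      unfolding l_def using p not_less_Least by (auto intro: LeastI Least_le)
    then have "first_132_at x l" using p unfolding first_132_at_def avoids by auto
    then show "\<exists>p. first_132_at x p" ..
  next
    fix p assume "first_132_at x p"
    then show "\<exists>p. occurs_at [1,3,2] x p \<and> (\<forall>q\<le>p. \<not> occurs_at [2,1,3] x q)"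
      unfolding first_132_at_def avoids using clash by (intro exI[of _ p]) (auto simp: le_less)
  qed
qed

lemma first_132_at_unique:
  assumes "first_132_at x p" "first_132_at x q"
  shows "p = q"
proof (rule ccontr)
  assume "p \<noteq> q"
  then have "p + 3 \<le> q + 2 \<or> q + 3 \<le> p + 2" by linarith
  then show False using assms unfolding first_132_at_def avoids_def by blast
qed

lemma measurable_occurs_at:
  fixes X :: "nat \<Rightarrow> 'a \<Rightarrow> real"
  assumes [measurable]: "\<And>i. X i \<in> borel_measurable M"
  shows "Measurable.pred M (\<lambda>\<omega>. occurs_at [1,3,2] (\<lambda>i. X i \<omega>) p)"
    and "Measurable.pred M (\<lambda>\<omega>. occurs_at [2,1,3] (\<lambda>i. X i \<omega>) p)"
  unfolding occurs_at_132_iff occurs_at_213_iff by measurable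

lemma measurable_avoids:
  fixes X :: "nat \<Rightarrow> 'a \<Rightarrow> real"
  assumes [measurable]: "\<And>i. X i \<in> borel_measurable M"
  shows "Measurable.pred M (\<lambda>\<omega>. avoids n (\<lambda>i. X i \<omega>))"
  unfolding avoids_def using measurable_occurs_at[OF assms] by measurable

text \<open>The upper bound comes from the same disjoint decomposition: if 132 wins, but not among the first
  \<open>m + 2\<close> variables, then these avoid both patterns.\<close>
lemma prob_before_sums:
  assumes iid: "iid_continuous M X"
  shows "(\<lambda>p. card (Av [1,3,2] {[1,3,2],[2,1,3]} (p + 3)) / fact (p + 3))
      sums prob_before M X [1,3,2] [2,1,3]" (is ?sums)
    and "prob_before M X [1,3,2] [2,1,3] \<le> Av_partial_sum m + card (avoiders (m + 2)) / fact (m + 2)" (is ?le)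
proof -
  interpret prob_space M using iid by (simp add: iid_continuous_def)
  have rv: "random_variable borel (X k)" for k
    using iid by (auto simp: indep_vars_def iid_continuous_def)
  let ?D = "\<lambda>p. {\<omega> \<in> space M. first_132_at (\<lambda>i. X i \<omega>) p}"
  let ?N = "{\<omega> \<in> space M. avoids (m + 2) (\<lambda>i. X i \<omega>)}"
  have D: "?D p \<in> sets M" for p
    using measurable_occurs_at[OF rv] measurable_avoids[OF rv] unfolding first_132_at_def by measurable
  have N: "?N \<in> sets M" using measurable_avoids[OF rv] by measurable
  have before: "prob_before M X [1,3,2] [2,1,3] = measure M (\<Union>p. ?D p)"
    unfolding prob_before_def first_132_before_213_iff by (intro arg_cong[where f = "measure M"]) auto
  have disj: "disjoint_family ?D"
    unfolding disjoint_family_on_def using first_132_at_unique by blast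
  have prob_D: "measure M (?D p) = card (Av [1,3,2] {[1,3,2],[2,1,3]} (p + 3)) / fact (p + 3)" for p
    unfolding Av_eq_first_132_at
  proof (rule prob_order_event[OF iid D])
    fix x :: "nat \<Rightarrow> real" and \<pi> :: "nat list"
    assume so: "same_order (p + 3) x ((!) \<pi>)"
    show "first_132_at x p \<longleftrightarrow> first_132_at ((!) \<pi>) p"
      unfolding first_132_at_def
      using same_order_occurs_at(1)[OF so, of p] same_order_avoids[OF so, of "p + 2"] by simp
  qed
  have prob_N: "measure M ?N = card (avoiders (m + 2)) / fact (m + 2)"
    unfolding avoiders_def
    by (rule prob_order_event[OF iid N]) (use same_order_avoids in auto)
  show ?sums
    using finite_measure_UNION[OF _ disj] D unfolding before prob_D by auto
  have "(\<Union>p. ?D p) \<subseteq> (\<Union>p<m. ?D p) \<union> ?N"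
  proof
    fix \<omega> assume "\<omega> \<in> (\<Union>p. ?D p)"
    then obtain p where p: "\<omega> \<in> ?D p" by blast
    show "\<omega> \<in> (\<Union>p<m. ?D p) \<union> ?N"
    proof (cases "p < m")
      case False
      then have "\<omega> \<in> ?N" using p by (auto simp: first_132_at_def avoids_def)
      then show ?thesis by blast
    qed (use p in blast)
  qed
  then have "measure M (\<Union>p. ?D p) \<le> measure M ((\<Union>p<m. ?D p) \<union> ?N)"
    using D N by (intro finite_measure_mono) auto
  also have "\<dots> \<le> measure M (\<Union>p<m. ?D p) + measure M ?N"
    using D N by (intro measure_Un_le) auto
  also have "measure M (\<Union>p<m. ?D p) = (\<Sum>p<m. measure M (?D p))"
    using D disj by (intro finite_measure_finite_Union) (auto simp: disjoint_family_on_def)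
  finally show ?le unfolding before prob_N prob_D Av_partial_sum_def .
qed

theorem corollary4p9:
  fixes M :: "'a measure" and X :: "nat \<Rightarrow> 'a \<Rightarrow> real"
  assumes "iid_continuous M X"
  shows "((\<lambda>n. \<Sum>i\<in>{1..n}. \<Sum>j\<in>{1..n} - {i}. real (start_count n i j) / fact n)
            has_sum prob_before M X [1,3,2] [2,1,3]) {3..} \<and>
         \<bar>prob_before M X [1,3,2] [2,1,3] - 0.461\<bar> < 0.0005"
proof
  let ?P = "prob_before M X [1,3,2] [2,1,3]"
  let ?c = "\<lambda>n. real (card (Av [1,3,2] {[1,3,2],[2,1,3]} n)) / fact n"
  have sums: "(\<lambda>p. ?c (p + 3)) sums ?P" by (rule prob_before_sums(1)[OF assms])
  have "((\<lambda>p. ?c (p + 3)) has_sum ?P) UNIV" by (rule sums_nonneg_imp_has_sum[OF sums]) simp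
  also have "?this \<longleftrightarrow> (?c has_sum ?P) {3..}"
    by (rule has_sum_reindex_bij_witness[of _ "\<lambda>n. n - 3" "\<lambda>p. p + 3"]) auto
  also have "\<dots> \<longleftrightarrow> ((\<lambda>n. \<Sum>i\<in>{1..n}. \<Sum>j\<in>{1..n} - {i}. real (start_count n i j) / fact n) has_sum ?P) {3..}"
  proof (rule has_sum_cong)
    fix n :: nat assume "n \<in> {3..}"
    then have "real (card (Av [1,3,2] {[1,3,2],[2,1,3]} n)) =
        (\<Sum>i\<in>{1..n}. \<Sum>j\<in>{1..n} - {i}. real (start_count n i j))"
      by (subst sum_start_count[symmetric]) auto
    then show "?c n = (\<Sum>i\<in>{1..n}. \<Sum>j\<in>{1..n} - {i}. real (start_count n i j) / fact n)"
      by (simp only: sum_divide_distrib)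
  qed
  finally show "((\<lambda>n. \<Sum>i\<in>{1..n}. \<Sum>j\<in>{1..n} - {i}. real (start_count n i j) / fact n) has_sum ?P) {3..}" .
  have "Av_partial_sum 21 \<le> ?P"
    unfolding Av_partial_sum_def sums_unique[OF sums]
    by (rule sum_le_suminf) (use sums in \<open>auto simp: sums_iff\<close>)
  moreover have "?P \<le> Av_partial_sum 21 + card (avoiders 23) / fact 23"
    using prob_before_sums(2)[OF assms, of 21] by simp
  ultimately have "0.4605 < ?P" "?P < 0.4615"
    using numeric_bounds by linarith+
  then show "\<bar>?P - 0.461\<bar> < 0.0005"
    unfolding abs_less_iff by (simp add: field_simps)
qed

end
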